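(* Let $a>0$ and $T>0$, and let $u=u(x,t)$ be an arbitrary solution of $$u_t=u_{xx}\ \text{ in } ]0,a[\,\times\,]0,T[,\qquad u_x(a,t)=0\ \text{ for } t\in\,]0,T[,\qquad u(x,0)=0\ \text{ in } ]0,a[.$$ Let $M$ be a positive number such that $M\ge 2a$. Let $T'$ satisfy $0<T'\le T$. Let $c$ be an arbitrary positive number satisfying $Mc<\min\{T,2T'\}$. Assume that $u_x(0,t)$ coincides on the interval $]0,T'[$ with a polynomial in $t$ at least one of whose coefficients is not $0$. For $\tau>c^{-2}$ and $s\in\mathbf{R}$ let $I_c(\tau;s)$ be the indicator function $$I_c(\tau;s)=e^{\tau s}\int_0^T\bigl(-v_x(0,t)u(0,t)+u_x(0,t)v(0,t)\bigr)\,dt,$$ where $v(x,t)=e^{-z^2t}e^{xz}$ and $z=-c\tau\left(1+i\sqrt{1-\frac{1}{c^2\tau}}\right)$. Then $$\lim_{\tau\to\infty}\frac{\log|I_c(\tau;0)|}{\tau}=-2ca,$$ and moreover: (i) if $s\le 2ca$, then $\lim_{\tau\to\infty}|I_c(\tau;s)|=0$; (ii) if $s>2ca$, then $\lim_{\tau\to\infty}|I_c(\tau;s)|=\infty$.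
   Context: $]\alpha,\beta[$ denotes an open interval. The function $v$ depends on the parameters $\tau$ and $c$, is complex valued, and satisfies the backward heat equation $v_t+v_{xx}=0$; note $z^2=\tau+2ic^2\tau^2\sqrt{1-\frac{1}{c^2\tau}}$. The paper does not specify a function class for solutions $u$; they are understood to be regular enough that the boundary values $u(0,t)$, $u_x(0,t)$, $u(a,t)$, the final value $u(x,T)$ and integrations by parts make sense. *)

theory Defs
  imports "HOL-Analysis.Analysis" "HOL-Computational_Algebra.Polynomial"
begin

text \<open>
  The spatial derivative \<open>u\<^sub>x(x,t)\<close> on the closed interval \<open>[0,a]\<close>; at \<open>x = 0\<close> and \<open>x = a\<close>
  it is the one-sided derivative, which gives the boundary values \<open>u\<^sub>x(0,t)\<close> and \<open>u\<^sub>x(a,t)\<close>.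
\<close>
definition dx :: "real \<Rightarrow> (real \<Rightarrow> real \<Rightarrow> real) \<Rightarrow> real \<Rightarrow> real \<Rightarrow> real" where
  "dx a u x t = vector_derivative (\<lambda>y. u y t) (at x within {0..a})"

definition dxx :: "real \<Rightarrow> (real \<Rightarrow> real \<Rightarrow> real) \<Rightarrow> real \<Rightarrow> real \<Rightarrow> real" where
  "dxx a u x t = deriv (\<lambda>y. dx a u y t) x"

definition dt :: "(real \<Rightarrow> real \<Rightarrow> real) \<Rightarrow> real \<Rightarrow> real \<Rightarrow> real" where
  "dt u x t = deriv (\<lambda>r. u x r) t"

text \<open>
  The function class for solutions: \<open>C\<^sup>2\<close> in \<open>x\<close> and \<open>C\<^sup>1\<close> in \<open>t\<close> inside, \<open>C\<^sup>1\<close> in \<open>x\<close> up to the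
  lateral boundary, continuous up to \<open>t = 0\<close> and \<open>t = T\<close>, with integrable flux at \<open>x = 0\<close>.
  Continuity of \<open>u\<^sub>x\<close> is not required at \<open>t = 0\<close>: a flux with \<open>u\<^sub>x(0,t) \<longrightarrow> p(0) \<noteq> 0\<close> as
  \<open>t \<longrightarrow> 0\<close> is incompatible with \<open>u(x,0) = 0\<close> in the corner \<open>(0,0)\<close>, but must be admitted.
\<close>
definition regular_on_strip :: "real \<Rightarrow> real \<Rightarrow> (real \<Rightarrow> real \<Rightarrow> real) \<Rightarrow> bool" where
  "regular_on_strip a T u \<longleftrightarrow>
     continuous_on ({0..a} \<times> {0..T}) (\<lambda>(x, t). u x t) \<and>
     (\<forall>x\<in>{0..a}. \<forall>t\<in>{0<..<T}. (\<lambda>y. u y t) differentiable (at x within {0..a})) \<and>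
     continuous_on ({0..a} \<times> {0<..<T}) (\<lambda>(x, t). dx a u x t) \<and>
     (\<lambda>t. dx a u 0 t) absolutely_integrable_on {0..T} \<and>
     (\<forall>x\<in>{0<..<a}. \<forall>t\<in>{0<..<T}. (\<lambda>y. dx a u y t) differentiable (at x)) \<and>
     continuous_on ({0<..<a} \<times> {0<..<T}) (\<lambda>(x, t). dxx a u x t) \<and>
     (\<forall>x\<in>{0<..<a}. \<forall>t\<in>{0<..<T}. (\<lambda>r. u x r) differentiable (at t)) \<and>
     continuous_on ({0<..<a} \<times> {0<..<T}) (\<lambda>(x, t). dt u x t)"

definition heat_solution :: "real \<Rightarrow> real \<Rightarrow> (real \<Rightarrow> real \<Rightarrow> real) \<Rightarrow> bool" where
  "heat_solution a T u \<longleftrightarrow>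
     regular_on_strip a T u \<and>
     (\<forall>x\<in>{0<..<a}. \<forall>t\<in>{0<..<T}. dt u x t = dxx a u x t) \<and>
     (\<forall>t\<in>{0<..<T}. dx a u a t = 0) \<and>
     (\<forall>x\<in>{0<..<a}. u x 0 = 0)"

text \<open>Meaningful for \<open>c > 0\<close> and \<open>\<tau> > c\<^sup>-\<^sup>2\<close>, where the argument of the square root is positive.\<close>
definition zpar :: "real \<Rightarrow> real \<Rightarrow> complex" where
  "zpar c \<tau> = - complex_of_real (c * \<tau>) * (1 + \<i> * complex_of_real (sqrt (1 - 1 / (c\<^sup>2 * \<tau>))))"

definition vfun :: "real \<Rightarrow> real \<Rightarrow> real \<Rightarrow> real \<Rightarrow> complex" where
  "vfun c \<tau> x t = exp (- ((zpar c \<tau>)\<^sup>2 * complex_of_real t)) * exp (complex_of_real x * zpar c \<tau>)"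

definition vfun_x :: "real \<Rightarrow> real \<Rightarrow> real \<Rightarrow> real \<Rightarrow> complex" where
  "vfun_x c \<tau> x t = vector_derivative (\<lambda>y. vfun c \<tau> y t) (at x)"

definition indicator_fun ::
  "real \<Rightarrow> real \<Rightarrow> (real \<Rightarrow> real \<Rightarrow> real) \<Rightarrow> real \<Rightarrow> real \<Rightarrow> real \<Rightarrow> complex" where
  "indicator_fun a T u c \<tau> s =
     complex_of_real (exp (\<tau> * s)) *
     integral {0..T} (\<lambda>t. - vfun_x c \<tau> 0 t * complex_of_real (u 0 t)
                          + complex_of_real (dx a u 0 t) * vfun c \<tau> 0 t)"

end

theory Submission
  imports Defs "HOL-Real_Asymp.Real_Asymp"
begin

text \<open>
  The integrand of the indicator function involves only the data \<open>u(0,t)\<close> and \<open>u\<^sub>x(0,t)\<close>; the idea is to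
  eliminate \<open>u(0,t)\<close> by means of the insulated end \<open>x = a\<close>.  Both \<open>exp (\<plusminus> x z - z\<^sup>2 t)\<close> solve the backward
  heat equation, and Green's identity on \<open>[0,a] \<times> [0,T]\<close> tests \<open>u\<close> against each of them.  With
  \<open>g = \<integral> u\<^sub>x(0,t) exp (-z\<^sup>2 t) dt\<close>, \<open>w\<close> and \<open>W\<close> the same transform of \<open>u(0,t)\<close> and \<open>u(a,t)\<close>, and
  \<open>E(\<zeta>) = \<integral> u(x,T) exp (x \<zeta> - \<zeta>\<^sup>2 T) dx\<close>, this gives two linear equations
  (lemma \<open>green_identity\<close> at \<open>\<zeta> = z\<close> and \<open>\<zeta> = -z\<close>)
    \<open>E(z) = - z e\<^bsup>az\<^esup> W - g + z w\<close>  and  \<open>E(-z) = z e\<^bsup>-az\<^esup> W - g - z w\<close>.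
  Here \<open>g - z w\<close> is the indicator function \<open>I\<close> at \<open>s = 0\<close>.  Eliminating the unknown \<open>W\<close> yields the exact formula
    \<open>e\<^bsup>-2az\<^esup> I (1 - e\<^bsup>2az\<^esup>) = - (2 g + E(-z) + e\<^bsup>-2az\<^esup> E(z))\<close>
  of lemma \<open>boundary_data_representation\<close>: the flux signal \<open>g\<close> travels to the far end and back, which
  accounts for the factor \<open>e\<^bsup>2az\<^esup>\<close> of modulus \<open>e\<^bsup>-2ca\<tau>\<^esup>\<close>.
  
  Since \<open>Re z\<^sup>2 = \<tau>\<close> and \<open>Re z = -c\<tau>\<close>, the terms with \<open>E\<close> are of size at most \<open>e\<^bsup>(2ca - T)\<tau>\<^esup>\<close>, which is
  exponentially small because \<open>2ca \<le> Mc < T\<close>.  The main term \<open>g\<close> is a Laplace transform at \<open>z\<^sup>2\<close> of a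
  function that starts as a nonzero polynomial; integration by parts shows that it behaves like a nonzero
  constant times a negative power of \<open>z\<^sup>2\<close> (lemma \<open>laplace_initially_polynomial_asymptotics\<close>, an instance of
  Watson's lemma along a complex path).  As \<open>|z\<^sup>2| = 2c\<^sup>2\<tau>\<^sup>2 - \<tau>\<close>, the product
  \<open>|I| e\<^bsup>2ca\<tau>\<^esup> (2c\<^sup>2\<tau>\<^sup>2 - \<tau>)\<^bsup>k+1\<^esup>\<close> has a positive limit for some \<open>k\<close> (lemma \<open>indicator_fun_asymptotics\<close>).
  All the claims follow; the algebraic factor is what makes \<open>|I|\<close> tend to \<open>0\<close> in the borderline
  case \<open>s = 2ca\<close>.
\<close>

section \<open>Laplace transforms on a bounded interval\<close>

lemma absolutely_integrable_mult_continuous: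
  fixes f :: "real \<Rightarrow> real" and w :: "real \<Rightarrow> complex"
  assumes "f absolutely_integrable_on {a..b}" "continuous_on {a..b} w"
  shows "(\<lambda>t. of_real (f t) * w t) absolutely_integrable_on {a..b}"
proof -
  have "bilinear (\<lambda>(w::complex) (r::real). of_real r * w)"
    by (auto simp: bilinear_def linear_iff algebra_simps scaleR_conv_of_real)
  moreover have "bounded (w ` {a..b})"
    using assms(2) by (intro compact_imp_bounded compact_continuous_image) auto
  moreover have "w \<in> borel_measurable (lebesgue_on {a..b})"
    using assms(2) by (intro continuous_imp_measurable_on_sets_lebesgue) auto
  ultimately show ?thesis
    using absolutely_integrable_bounded_measurable_product[of "\<lambda>w r. of_real r * w" w "{a..b}" f]
      assms(1) by auto
qed

lemma laplace_integrable:
  assumes "f absolutely_integrable_on {a..b}"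
  shows "(\<lambda>t. of_real (f t) * exp (- (\<mu> * complex_of_real t))) integrable_on {a..b}"
proof -
  have "continuous_on {a..b} (\<lambda>t. exp (- (\<mu> * complex_of_real t)))"
    by (intro continuous_intros)
  from absolutely_integrable_mult_continuous[OF assms this]
  show ?thesis by (simp add: absolutely_integrable_on_def)
qed

lemma norm_exp_neg_mult_of_real:
  fixes \<mu> :: complex
  shows "norm (exp (- (\<mu> * of_real t))) = exp (- (Re \<mu> * t))"
  by (simp add: norm_exp_eq_Re)

lemma polynomial_laplace_integrable:
  "(\<lambda>t. of_real (poly p t) * exp (- (\<mu> * complex_of_real t))) integrable_on {a..b}"
  by (intro integrable_continuous_real continuous_intros)

text \<open>
  This recursion drives all the asymptotics: it trades a factor \<open>\<mu>\<close> for one derivative of \<open>p\<close>, at the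
  cost of the two end-point values.
\<close>

lemma laplace_polynomial_by_parts:
  fixes p :: "real poly" and \<mu> :: complex
  assumes "0 < b"
  shows "\<mu> * integral {0..b} (\<lambda>t. of_real (poly p t) * exp (- (\<mu> * of_real t)))
       = of_real (poly p 0) - of_real (poly p b) * exp (- (\<mu> * of_real b))
         + integral {0..b} (\<lambda>t. of_real (poly (pderiv p) t) * exp (- (\<mu> * of_real t)))"
proof -
  let ?e = "\<lambda>t. exp (- (\<mu> * complex_of_real t))"
  have "((\<lambda>t. of_real (poly p t) * ?e t) has_vector_derivative
          of_real (poly (pderiv p) t) * ?e t - \<mu> * (of_real (poly p t) * ?e t)) (at t within {0..b})" for t
  proof -
    have "((\<lambda>w. exp (- (\<mu> * w))) has_field_derivative - \<mu> * ?e t) (at (of_real t))"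
      by (auto intro!: derivative_eq_intros)
    from has_vector_derivative_mult[OF has_vector_derivative_of_real[OF
        has_field_derivative_at_within[OF poly_DERIV[of p t]]] has_vector_derivative_real_field[OF this]]
    show ?thesis by (rule has_vector_derivative_eq_rhs) (simp add: algebra_simps)
  qed
  then have "((\<lambda>t. of_real (poly (pderiv p) t) * ?e t - \<mu> * (of_real (poly p t) * ?e t)) has_integral
      of_real (poly p b) * ?e b - of_real (poly p 0) * ?e 0) {0..b}"
    using assms by (intro fundamental_theorem_of_calculus) auto
  from integral_unique[OF this] show ?thesis
    by (subst (asm) integral_diff)
       (auto intro!: polynomial_laplace_integrable integrable_on_mult_right simp: algebra_simps)
qed

lemma norm_laplace_integral_le:
  fixes f :: "real \<Rightarrow> real" and \<mu> :: complex
  assumes "f absolutely_integrable_on {a..b}" "0 \<le> Re \<mu>"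
  shows "norm (integral {a..b} (\<lambda>t. of_real (f t) * exp (- (\<mu> * of_real t))))
       \<le> exp (- (Re \<mu> * a)) * integral {a..b} (\<lambda>t. \<bar>f t\<bar>)"
proof -
  have "norm (integral {a..b} (\<lambda>t. of_real (f t) * exp (- (\<mu> * of_real t))))
      \<le> integral {a..b} (\<lambda>t. exp (- (Re \<mu> * a)) * \<bar>f t\<bar>)"
  proof (rule integral_norm_bound_integral[OF laplace_integrable[OF assms(1)]])
    show "(\<lambda>t. exp (- (Re \<mu> * a)) * \<bar>f t\<bar>) integrable_on {a..b}"
      using assms(1) by (intro integrable_on_mult_right) (simp add: absolutely_integrable_on_def)
    fix t assume "t \<in> {a..b}"
    then have "exp (- (Re \<mu> * t)) \<le> exp (- (Re \<mu> * a))"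
      using assms(2) by (simp add: mult_left_mono)
    then show "norm (of_real (f t) * exp (- (\<mu> * of_real t))) \<le> exp (- (Re \<mu> * a)) * \<bar>f t\<bar>"
      by (simp add: norm_mult norm_exp_neg_mult_of_real mult_left_mono mult.commute)
  qed
  then show ?thesis by simp
qed

text \<open>
  One integration by parts suffices: it expresses \<open>\<mu>\<close> times the transform by quantities that stay
  bounded as long as \<open>Re \<mu> \<ge> 0\<close>.
\<close>

lemma laplace_polynomial_tendsto_0:
  fixes lam :: "'a \<Rightarrow> complex"
  assumes "0 < b" and Re: "filterlim (\<lambda>x. Re (lam x)) at_top F"
  shows "((\<lambda>x. integral {0..b} (\<lambda>t. of_real (poly p t) * exp (- (lam x * of_real t)))) \<longlongrightarrow> 0) F"
proof -
  define C where "C = \<bar>poly p 0\<bar> + \<bar>poly p b\<bar> + integral {0..b} (\<lambda>t. \<bar>poly (pderiv p) t\<bar>)"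
  have "((\<lambda>x. C / Re (lam x)) \<longlongrightarrow> 0) F"
    by (intro tendsto_divide_0[OF tendsto_const] filterlim_at_top_imp_at_infinity Re)
  moreover have "\<forall>\<^sub>F x in F. norm (integral {0..b} (\<lambda>t. of_real (poly p t) * exp (- (lam x * of_real t))))
       \<le> C / Re (lam x)"
    using filterlim_at_top_dense[THEN iffD1, OF Re, rule_format, of 0]
  proof eventually_elim
    case (elim x)
    let ?L = "\<lambda>p. integral {0..b} (\<lambda>t. of_real (poly p t) * exp (- (lam x * of_real t)))"
    have L: "norm (?L (pderiv p)) \<le> integral {0..b} (\<lambda>t. \<bar>poly (pderiv p) t\<bar>)"
      using norm_laplace_integral_le[OF absolutely_integrable_continuous_real[OF continuous_on_poly[OF continuous_on_id]],
          of "lam x" 0 b "pderiv p"] elim by simp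
    have e: "norm (of_real (poly p b) * exp (- (lam x * of_real b))) \<le> \<bar>poly p b\<bar>"
      using elim \<open>0 < b\<close> by (simp add: norm_mult norm_exp_neg_mult_of_real mult_left_le)
    have "Re (lam x) * norm (?L p) \<le> norm (lam x) * norm (?L p)"
      by (intro mult_right_mono complex_Re_le_cmod) auto
    also have "\<dots> = norm (of_real (poly p 0) - of_real (poly p b) * exp (- (lam x * of_real b)) + ?L (pderiv p))"
      unfolding norm_mult[symmetric] laplace_polynomial_by_parts[OF \<open>0 < b\<close>] ..
    also have "\<dots> \<le> C"
      unfolding C_def using L e
      by (intro order.trans[OF norm_triangle_ineq] add_mono order.trans[OF norm_triangle_ineq4]) auto
    finally show ?case using elim by (simp add: field_simps)
  qed
  ultimately show ?thesis by (rule Lim_null_comparison[rotated])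
qed

text \<open>
  If \<open>p(0) \<noteq> 0\<close>, then \<open>\<mu>\<close> times the transform tends to \<open>p(0)\<close>; otherwise one integration by parts passes
  to \<open>p'\<close>, which is nonzero and of smaller degree.  Thus \<open>k\<close> is the order of vanishing of \<open>p\<close> at \<open>0\<close>
  and \<open>C\<close> is the \<open>k\<close>-th derivative of \<open>p\<close> there.  The contribution of the end point \<open>b\<close> is negligible
  by the hypothesis \<open>decay\<close>, which says that \<open>|lam|\<close> grows at most subexponentially compared with
  \<open>Re lam\<close>.
\<close>

lemma laplace_polynomial_asymptotics:
  fixes lam :: "'a \<Rightarrow> complex" and p :: "real poly"
  assumes "0 < b" and Re: "filterlim (\<lambda>x. Re (lam x)) at_top F"
    and decay: "\<And>n \<epsilon>. \<epsilon> > 0 \<Longrightarrow> ((\<lambda>x. norm (lam x) ^ n * exp (- (Re (lam x) * \<epsilon>))) \<longlongrightarrow> 0) F"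
    and "p \<noteq> 0"
  shows "\<exists>k C. C \<noteq> 0 \<and> ((\<lambda>x. lam x ^ Suc k *
      integral {0..b} (\<lambda>t. of_real (poly p t) * exp (- (lam x * of_real t)))) \<longlongrightarrow> C) F"
  using \<open>p \<noteq> 0\<close>
proof (induction "degree p" arbitrary: p rule: less_induct)
  case less
  let ?L = "\<lambda>p x. integral {0..b} (\<lambda>t. of_real (poly p t) * exp (- (lam x * of_real t)))"
  have ends: "((\<lambda>x. lam x ^ n * (of_real (poly p b) * exp (- (lam x * of_real b)))) \<longlongrightarrow> 0) F" for n
  proof (rule tendsto_norm_zero_cancel)
    have "((\<lambda>x. \<bar>poly p b\<bar> * (norm (lam x) ^ n * exp (- (Re (lam x) * b)))) \<longlongrightarrow> \<bar>poly p b\<bar> * 0) F"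
      by (intro tendsto_intros decay \<open>0 < b\<close>)
    then show "((\<lambda>x. norm (lam x ^ n * (of_real (poly p b) * exp (- (lam x * of_real b))))) \<longlongrightarrow> 0) F"
      by (simp add: norm_mult norm_power norm_exp_neg_mult_of_real mult_ac)
  qed
  show ?case
  proof (cases "poly p 0 = 0")
    case False
    have "((\<lambda>x. of_real (poly p 0) - lam x ^ 0 * (of_real (poly p b) * exp (- (lam x * of_real b)))
             + ?L (pderiv p) x) \<longlongrightarrow> of_real (poly p 0) - 0 + 0) F"
      by (intro tendsto_intros ends laplace_polynomial_tendsto_0 assms)
    then have "((\<lambda>x. lam x ^ Suc 0 * ?L p x) \<longlongrightarrow> of_real (poly p 0)) F"
      by (simp add: laplace_polynomial_by_parts[OF \<open>0 < b\<close>])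
    with False show ?thesis
      by (intro exI[of _ 0] exI[of _ "of_real (poly p 0)"] conjI) auto
  next
    case True
    have "degree p \<noteq> 0"
    proof
      assume "degree p = 0"
      then obtain r where "p = [:r:]" by (rule degree_eq_zeroE)
      with True less.prems show False by simp
    qed
    then have "pderiv p \<noteq> 0" "degree (pderiv p) < degree p"
      by (auto simp: pderiv_eq_0_iff degree_pderiv)
    from less.hyps[OF this(2,1)] obtain k and C :: complex where
      C: "C \<noteq> 0" "((\<lambda>x. lam x ^ Suc k * ?L (pderiv p) x) \<longlongrightarrow> C) F" by blast
    have "((\<lambda>x. lam x ^ Suc k * ?L (pderiv p) x
             - lam x ^ Suc k * (of_real (poly p b) * exp (- (lam x * of_real b)))) \<longlongrightarrow> C - 0) F"
      by (intro tendsto_diff C ends)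
    also have "(\<lambda>x. lam x ^ Suc k * ?L (pderiv p) x
             - lam x ^ Suc k * (of_real (poly p b) * exp (- (lam x * of_real b))))
          = (\<lambda>x. lam x ^ Suc (Suc k) * ?L p x)"
    proof
      fix x
      have "lam x ^ Suc (Suc k) * ?L p x = lam x ^ Suc k * (lam x * ?L p x)" by simp
      then show "lam x ^ Suc k * ?L (pderiv p) x
             - lam x ^ Suc k * (of_real (poly p b) * exp (- (lam x * of_real b)))
          = lam x ^ Suc (Suc k) * ?L p x"
        unfolding laplace_polynomial_by_parts[OF \<open>0 < b\<close>] using True by (simp add: algebra_simps)
    qed
    finally have "((\<lambda>x. lam x ^ Suc (Suc k) * ?L p x) \<longlongrightarrow> C) F" by simp
    with C(1) show ?thesis by blast
  qed
qed

text \<open>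
  What happens after time \<open>b\<close> is weighted by at most \<open>exp (- b Re lam)\<close> and cannot affect the algebraic
  behaviour that comes from the start of \<open>f\<close>.
\<close>

lemma laplace_initially_polynomial_asymptotics:
  fixes lam :: "'a \<Rightarrow> complex" and p :: "real poly" and f :: "real \<Rightarrow> real"
  assumes "0 < b" "b \<le> T" and Re: "filterlim (\<lambda>x. Re (lam x)) at_top F"
    and decay: "\<And>n \<epsilon>. \<epsilon> > 0 \<Longrightarrow> ((\<lambda>x. norm (lam x) ^ n * exp (- (Re (lam x) * \<epsilon>))) \<longlongrightarrow> 0) F"
    and f: "f absolutely_integrable_on {0..T}"
    and "p \<noteq> 0" "\<And>t. t \<in> {0<..<b} \<Longrightarrow> f t = poly p t"
  shows "\<exists>k C. C \<noteq> 0 \<and> ((\<lambda>x. lam x ^ Suc k *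
      integral {0..T} (\<lambda>t. of_real (f t) * exp (- (lam x * of_real t)))) \<longlongrightarrow> C) F"
proof -
  let ?L = "\<lambda>f S x. integral S (\<lambda>t. of_real (f t) * exp (- (lam x * of_real t)))"
  obtain k and C :: complex where C: "C \<noteq> 0" "((\<lambda>x. lam x ^ Suc k * ?L (poly p) {0..b} x) \<longlongrightarrow> C) F"
    using laplace_polynomial_asymptotics[OF \<open>0 < b\<close> Re decay \<open>p \<noteq> 0\<close>] by blast
  have tail: "((\<lambda>x. lam x ^ Suc k * ?L f {b..T} x) \<longlongrightarrow> 0) F"
  proof (rule Lim_null_comparison)
    let ?K = "integral {b..T} (\<lambda>t. \<bar>f t\<bar>)"
    show "((\<lambda>x. ?K * (norm (lam x) ^ Suc k * exp (- (Re (lam x) * b)))) \<longlongrightarrow> 0) F"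
      by (rule tendsto_mult_right_zero decay \<open>0 < b\<close>)+
    show "\<forall>\<^sub>F x in F. norm (lam x ^ Suc k * ?L f {b..T} x) \<le> ?K * (norm (lam x) ^ Suc k * exp (- (Re (lam x) * b)))"
      using filterlim_at_top_dense[THEN iffD1, OF Re, rule_format, of 0]
    proof eventually_elim
      case (elim x)
      have "norm (?L f {b..T} x) \<le> exp (- (Re (lam x) * b)) * ?K"
        using assms(1,2) elim
        by (intro norm_laplace_integral_le absolutely_integrable_on_subinterval[OF f]) auto
      then have "norm (lam x) ^ Suc k * norm (?L f {b..T} x) \<le> norm (lam x) ^ Suc k * (exp (- (Re (lam x) * b)) * ?K)"
        by (intro mult_left_mono) auto
      then show ?case by (simp add: norm_mult norm_power mult_ac)
    qed
  qed
  have "lam x ^ Suc k * ?L f {0..T} x = lam x ^ Suc k * ?L (poly p) {0..b} x + lam x ^ Suc k * ?L f {b..T} x" for x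
  proof -
    have "?L f {0..T} x = ?L f {0..b} x + ?L f {b..T} x"
      using assms(1,2) laplace_integrable[OF f] by (intro Henstock_Kurzweil_Integration.integral_combine[symmetric]) auto
    also have "?L f {0..b} x = ?L (poly p) {0..b} x"
      by (rule integral_spike[of "{0,b}"]) (use assms in auto)
    finally show ?thesis by (simp add: algebra_simps)
  qed
  then have "((\<lambda>x. lam x ^ Suc k * ?L f {0..T} x) \<longlongrightarrow> C) F"
    using tendsto_add[OF C(2) tail] by (simp only: add_0_right)
  with C(1) show ?thesis by blast
qed

section \<open>Green's identity for the insulated rod\<close>

text \<open>
  The separated solutions of the backward heat equation \<open>v\<^sub>t + v\<^sub>x\<^sub>x = 0\<close>.  The function \<open>vfun\<close> is the case
  \<open>\<zeta> = z\<close>; its mirror image \<open>\<zeta> = - z\<close> is the second test function.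
\<close>

definition heat_exp :: "complex \<Rightarrow> real \<Rightarrow> real \<Rightarrow> complex" where
  "heat_exp \<zeta> x t = exp (of_real x * \<zeta> - \<zeta>\<^sup>2 * of_real t)"

lemma heat_exp_has_vector_derivative_space:
  "((\<lambda>x. heat_exp \<zeta> x t) has_vector_derivative \<zeta> * heat_exp \<zeta> x t) (at x within S)"
proof -
  have "((\<lambda>w. exp (w * \<zeta> - \<zeta>\<^sup>2 * of_real t)) has_field_derivative
          \<zeta> * exp (of_real x * \<zeta> - \<zeta>\<^sup>2 * of_real t)) (at (of_real x))"
    by (auto intro!: derivative_eq_intros)
  from has_vector_derivative_real_field[OF this] show ?thesis unfolding heat_exp_def .
qed

lemma heat_exp_has_vector_derivative_time:
  "((\<lambda>t. heat_exp \<zeta> x t) has_vector_derivative - \<zeta>\<^sup>2 * heat_exp \<zeta> x t) (at t within S)"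
proof -
  have "((\<lambda>w. exp (of_real x * \<zeta> - \<zeta>\<^sup>2 * w)) has_field_derivative
          - \<zeta>\<^sup>2 * exp (of_real x * \<zeta> - \<zeta>\<^sup>2 * of_real t)) (at (of_real t))"
    by (auto intro!: derivative_eq_intros)
  from has_vector_derivative_real_field[OF this] show ?thesis unfolding heat_exp_def .
qed

lemma continuous_on_heat_exp [continuous_intros]:
  assumes "continuous_on S f" "continuous_on S g"
  shows "continuous_on S (\<lambda>s. heat_exp \<zeta> (f s) (g s))"
  unfolding heat_exp_def by (intro continuous_intros assms)

text \<open>
  The heat equation is used in the form \<open>has_dt_dx\<close>: the space derivative of \<open>u\<^sub>x\<close> is \<open>u\<^sub>t\<close>.  This removes
  \<open>dxx\<close> from all that follows.
\<close>

lemma heat_solutionD: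
  assumes "heat_solution a T u"
  shows continuous_on_closed_strip: "continuous_on ({0..a} \<times> {0..T}) (\<lambda>(x, t). u x t)"
    and continuous_on_dx: "continuous_on ({0..a} \<times> {0<..<T}) (\<lambda>(x, t). dx a u x t)"
    and continuous_on_dt: "continuous_on ({0<..<a} \<times> {0<..<T}) (\<lambda>(x, t). dt u x t)"
    and flux_absolutely_integrable: "(\<lambda>t. dx a u 0 t) absolutely_integrable_on {0..T}"
    and insulated_end: "\<And>t. t \<in> {0<..<T} \<Longrightarrow> dx a u a t = 0"
    and has_dx: "\<And>x t. x \<in> {0<..<a} \<Longrightarrow> t \<in> {0<..<T} \<Longrightarrow>
           ((\<lambda>y. u y t) has_real_derivative dx a u x t) (at x)"
    and has_dt_dx: "\<And>x t. x \<in> {0<..<a} \<Longrightarrow> t \<in> {0<..<T} \<Longrightarrow>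
           ((\<lambda>y. dx a u y t) has_real_derivative dt u x t) (at x)"
    and has_dt: "\<And>x t. x \<in> {0<..<a} \<Longrightarrow> t \<in> {0<..<T} \<Longrightarrow>
           ((\<lambda>r. u x r) has_real_derivative dt u x t) (at t)"
proof -
  note h = assms[unfolded heat_solution_def regular_on_strip_def]
  show "continuous_on ({0..a} \<times> {0..T}) (\<lambda>(x, t). u x t)"
    "continuous_on ({0..a} \<times> {0<..<T}) (\<lambda>(x, t). dx a u x t)"
    "continuous_on ({0<..<a} \<times> {0<..<T}) (\<lambda>(x, t). dt u x t)"
    "(\<lambda>t. dx a u 0 t) absolutely_integrable_on {0..T}"
    "\<And>t. t \<in> {0<..<T} \<Longrightarrow> dx a u a t = 0"
    using h by auto
  fix x t :: real assume x: "x \<in> {0<..<a}" and t: "t \<in> {0<..<T}"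
  have "(\<lambda>y. u y t) differentiable (at x within {0..a})"
    using h x t by auto
  then have "((\<lambda>y. u y t) has_real_derivative dx a u x t) (at x within {0..a})"
    unfolding dx_def has_real_derivative_iff_has_vector_derivative by (simp add: vector_derivative_works)
  moreover have "at x within {0..a} = at x"
    using x by (intro at_within_interior) auto
  ultimately show "((\<lambda>y. u y t) has_real_derivative dx a u x t) (at x)" by simp
  have "(\<lambda>y. dx a u y t) differentiable (at x)" using h x t by auto
  then have "((\<lambda>y. dx a u y t) has_real_derivative dxx a u x t) (at x)"
    unfolding dxx_def
    by (simp add: DERIV_deriv_iff_real_differentiable)
  then show "((\<lambda>y. dx a u y t) has_real_derivative dt u x t) (at x)"
    using h x t by auto
  have "(\<lambda>r. u x r) differentiable (at t)" using h x t by auto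
  then show "((\<lambda>r. u x r) has_real_derivative dt u x t) (at t)"
    unfolding dt_def
    by (simp add: DERIV_deriv_iff_real_differentiable)
qed

text \<open>
  Multiplying the heat equation by a solution \<open>v\<close> of the backward equation gives
  \<open>(u\<^sub>x v - u v\<^sub>x)\<^sub>x = (u v)\<^sub>t\<close>, so the integral of this function over a rectangle can be evaluated in either
  order.  The derivatives \<open>u\<^sub>t\<close> and \<open>u\<^sub>x\<^sub>x\<close> may blow up at the lateral boundary.  Therefore no double integral
  is formed: the difference \<open>G\<close> of the two sides, up to a constant and as a function of the right end \<open>x\<close> of the rectangle,
  has derivative \<open>0\<close> in the open interval and is continuous on the closed one.
\<close>

lemma green_identity_interior_times:
  fixes \<zeta> :: complex
  assumes u: "heat_solution a T u" and "a > 0" and t: "0 < t1" "t1 \<le> t2" "t2 < T"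
  defines "b \<equiv> \<lambda>x t. of_real (dx a u x t) * heat_exp \<zeta> x t
                        - of_real (u x t) * (\<zeta> * heat_exp \<zeta> x t)"
  shows "integral {t1..t2} (b a) - integral {t1..t2} (b 0)
       = integral {0..a} (\<lambda>x. of_real (u x t2) * heat_exp \<zeta> x t2)
         - integral {0..a} (\<lambda>x. of_real (u x t1) * heat_exp \<zeta> x t1)"
proof -
  \<comment> \<open>The common value of \<open>(u\<^sub>x v - u v\<^sub>x)\<^sub>x\<close> and \<open>(u v)\<^sub>t\<close>.\<close>
  define q where "q = (\<lambda>x t. (of_real (dt u x t) - \<zeta>\<^sup>2 * of_real (u x t)) * heat_exp \<zeta> x t)"
  define K where "K = (\<lambda>x. of_real (u x t2) * heat_exp \<zeta> x t2 - of_real (u x t1) * heat_exp \<zeta> x t1)"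
  define G where "G = (\<lambda>x. integral {t1..t2} (b x) - integral {0..x} K)"
  note cu = continuous_on_closed_strip[OF u]
  note cdx = continuous_on_dx[OF u]
  note cdt = continuous_on_dt[OF u]
  have cu1: "continuous_on S (\<lambda>s. u (f s) (g s))"
    if "continuous_on S f" "continuous_on S g" "\<And>s. s \<in> S \<Longrightarrow> f s \<in> {0..a} \<and> g s \<in> {0..T}" 
    for S :: "'z::topological_space set" and f g
    using continuous_on_compose2[OF cu, of S "\<lambda>s. (f s, g s)"] that
    by (auto intro!: continuous_intros simp: image_subset_iff)
  have cb: "continuous_on ({0..a} \<times> cbox t1 t2) (\<lambda>(x,t). b x t)"
    unfolding b_def case_prod_unfold
    using t by (intro continuous_intros cu1 continuous_on_compose2[OF cdx[unfolded case_prod_unfold], of _ "\<lambda>s. s", simplified])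
       auto
  have cq: "continuous_on ({0<..<a} \<times> cbox t1 t2) (\<lambda>(x,t). q x t)"
    unfolding q_def case_prod_unfold
    using t by (intro continuous_intros cu1 continuous_on_compose2[OF cdt[unfolded case_prod_unfold], of _ "\<lambda>s. s", simplified])
       auto
  have cK: "continuous_on {0..a} K"
    unfolding K_def using t by (intro continuous_intros cu1) auto
  have db: "((\<lambda>x. b x t) has_vector_derivative q x t) (at x)"
    if "x \<in> {0<..<a}" "t \<in> cbox t1 t2" for x t
  proof -
    have t': "t \<in> {0<..<T}" using that t by auto
    show ?thesis unfolding b_def
      apply (rule has_vector_derivative_eq_rhs)
       apply (rule derivative_intros heat_exp_has_vector_derivative_space
           has_vector_derivative_of_real has_dx[OF u that(1) t'] has_dt_dx[OF u that(1) t']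
           has_vector_derivative_mult has_vector_derivative_diff)+
      by (simp add: q_def algebra_simps power2_eq_square)
  qed
  have dK: "integral {t1..t2} (q x) = K x" if x: "x \<in> {0<..<a}" for x
  proof -
    have "((\<lambda>t. of_real (u x t) * heat_exp \<zeta> x t) has_vector_derivative q x t) (at t within {t1..t2})"
      if tt: "t \<in> {t1..t2}" for t
    proof -
      have t': "t \<in> {0<..<T}" using tt t by auto
      show ?thesis
      apply (rule has_vector_derivative_eq_rhs)
       apply (rule derivative_intros heat_exp_has_vector_derivative_time
           has_vector_derivative_of_real has_dt[OF u x t', THEN has_field_derivative_at_within]
           has_vector_derivative_mult)+
      by (simp add: q_def algebra_simps power2_eq_square)
    qed
    from fundamental_theorem_of_calculus[OF \<open>t1 \<le> t2\<close> this]
    show ?thesis by (auto simp: K_def dest: integral_unique)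
  qed
  have cG: "continuous_on {0..a} G"
    unfolding G_def
    using integral_continuous_on_param[OF cb]
    by (auto intro!: continuous_intros indefinite_integral_continuous_1 integrable_continuous_real cK)
  have dG: "(G has_derivative (\<lambda>h. 0)) (at x within {0..a})" if "x \<in> {0..a} - {0,a}" for x
  proof -
    have x: "x \<in> {0<..<a}" using that by auto
    have "((\<lambda>x. integral (cbox t1 t2) (b x)) has_vector_derivative integral (cbox t1 t2) (q x))
           (at x within {0<..<a})"
    proof (rule leibniz_rule_vector_derivative[OF _ _ cq x])
      show "b y integrable_on cbox t1 t2" if "y \<in> {0<..<a}" for y
        using continuous_on_compose2[OF cb, of "cbox t1 t2" "\<lambda>t. (y,t)"]
          continuous_on_Pair[of "cbox t1 t2" "\<lambda>t. y" "\<lambda>t. t"] that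
        by (intro integrable_continuous) (auto simp: image_subset_iff)
    qed (rule has_vector_derivative_at_within[OF db], auto)
    moreover have "at x within {0<..<a} = at x" using x by (intro at_within_open) auto
    ultimately have 1: "((\<lambda>x. integral {t1..t2} (b x)) has_vector_derivative K x) (at x)"
      by (simp only: dK[OF x] box_real)
    have "((\<lambda>x. integral {0..x} K) has_vector_derivative K x) (at x within {0..a})"
      using x cK by (intro integral_has_vector_derivative) auto
    from has_vector_derivative_diff[OF has_vector_derivative_at_within[OF 1] this]
    show ?thesis unfolding G_def by (simp add: has_vector_derivative_def)
  qed
  have "G a = G 0"
    using \<open>a > 0\<close> by (intro has_derivative_zero_unique_strong_interval[where k = "{0,a}", OF _ cG refl dG]) auto
  moreover have "integral {0..a} K = integral {0..a} (\<lambda>x. of_real (u x t2) * heat_exp \<zeta> x t2)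
         - integral {0..a} (\<lambda>x. of_real (u x t1) * heat_exp \<zeta> x t1)"
    unfolding K_def using t
    by (intro integral_diff integrable_continuous_real continuous_intros cu1) auto
  ultimately show ?thesis by (simp add: G_def algebra_simps)
qed

text \<open>
  The flux \<open>u\<^sub>x(x,t)\<close> is controlled up to \<open>t = 0\<close> and \<open>t = T\<close> only at the two ends of the rod, where it is
  integrable respectively \<open>0\<close>.  After \<open>u\<^sub>x(a,t) = 0\<close> has been inserted, the difference \<open>P\<close> of the two sides
  as a function of the final time makes sense on all of \<open>[0,T]\<close> and is continuous there.  By the previous
  lemma it is constant on \<open>]0,T[\<close>, hence on \<open>[0,T]\<close>, and it vanishes at \<open>0\<close> by the initial condition.
\<close>

lemma green_identity:
  assumes u: "heat_solution a T u" and "a > 0" "T > 0"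
  shows "integral {0..a} (\<lambda>x. of_real (u x T) * heat_exp \<zeta> x T)
       = - \<zeta> * exp (of_real a * \<zeta>) * integral {0..T} (\<lambda>t. of_real (u a t) * exp (- (\<zeta>\<^sup>2 * of_real t)))
         - integral {0..T} (\<lambda>t. of_real (dx a u 0 t) * exp (- (\<zeta>\<^sup>2 * of_real t)))
         + \<zeta> * integral {0..T} (\<lambda>t. of_real (u 0 t) * exp (- (\<zeta>\<^sup>2 * of_real t)))"
proof -
  note cu = continuous_on_closed_strip[OF u]
  define e where "e = (\<lambda>t. exp (- (\<zeta>\<^sup>2 * complex_of_real t)))"
  have he: "heat_exp \<zeta> x t = exp (of_real x * \<zeta>) * e t" for x t
    by (simp add: heat_exp_def e_def exp_diff exp_minus field_simps)
  have ce: "continuous_on S e" for S unfolding e_def by (intro continuous_intros)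
  define B where "B = (\<lambda>t. - (\<zeta> * exp (of_real a * \<zeta>) * (of_real (u a t) * e t))
                       - of_real (dx a u 0 t) * e t + \<zeta> * (of_real (u 0 t) * e t))"
  have cu1: "continuous_on {0..T} (\<lambda>t. u x t)" if "x \<in> {0..a}" for x
    using continuous_on_compose2[OF cu, of "{0..T}" "\<lambda>t. (x,t)"]
      continuous_on_Pair[of "{0..T}" "\<lambda>t. x" "\<lambda>t. t"] that
    by (auto simp: image_subset_iff)
  have ia: "(\<lambda>t. of_real (u a t) * e t) integrable_on {0..T}"
       "(\<lambda>t. of_real (u 0 t) * e t) integrable_on {0..T}"
    using \<open>a > 0\<close> by (auto intro!: integrable_continuous_real continuous_intros cu1 ce)
  have ig: "(\<lambda>t. of_real (dx a u 0 t) * e t) integrable_on {0..T}"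
    unfolding e_def by (rule laplace_integrable[OF flux_absolutely_integrable[OF u]])
  have iB: "B integrable_on {0..T}"
    unfolding B_def
    by (intro integrable_add integrable_diff integrable_neg integrable_on_mult_right ia ig)
  define P where "P = (\<lambda>t. integral {0..a} (\<lambda>x. of_real (u x t) * heat_exp \<zeta> x t) - integral {0..t} B)"
  have cP: "continuous_on {0..T} P"
  proof -
    have "continuous_on ({0..T} \<times> cbox 0 a) (\<lambda>(t,x). of_real (u x t) * heat_exp \<zeta> x t)"
      unfolding case_prod_unfold
      using continuous_on_compose2[OF cu, of "{0..T} \<times> cbox 0 a" "\<lambda>s. (snd s, fst s)"]
        continuous_on_Pair[OF continuous_on_snd[OF continuous_on_id] continuous_on_fst[OF continuous_on_id],
          of "{0..T} \<times> cbox 0 a"]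
      by (auto intro!: continuous_on_mult continuous_on_of_real continuous_on_heat_exp
           continuous_on_fst continuous_on_snd continuous_on_id simp: image_subset_iff)
    from integral_continuous_on_param[OF this]
    show ?thesis unfolding P_def 
      by (auto intro!: continuous_intros indefinite_integral_continuous_1 iB)
  qed
  have const: "P t = P (T/2)" if "t \<in> {0<..<T}" for t
  proof -
    have *: "P t1 = P t2" if t: "0 < t1" "t1 \<le> t2" "t2 < T" for t1 t2
    proof -
      have i: "f integrable_on {t1..t2}" if "f integrable_on {0..T}" for f :: "real \<Rightarrow> complex"
        using that t by (auto intro: integrable_on_subinterval)
      have "integral {t1..t2} B = 
         integral {t1..t2} (\<lambda>t. of_real (dx a u a t) * heat_exp \<zeta> a t
                        - of_real (u a t) * (\<zeta> * heat_exp \<zeta> a t)) - 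
         integral {t1..t2} (\<lambda>t. of_real (dx a u 0 t) * heat_exp \<zeta> 0 t
                        - of_real (u 0 t) * (\<zeta> * heat_exp \<zeta> 0 t))" (is "_ = integral _ ?f - integral _ ?g")
      proof -
        have 1: "integral {t1..t2} ?f = integral {t1..t2} (\<lambda>t. - (\<zeta> * exp (of_real a * \<zeta>) * (of_real (u a t) * e t)))"
          using t insulated_end[OF u] by (intro integral_cong) (simp add: he)
        have 2: "?g = (\<lambda>t. of_real (dx a u 0 t) * e t - \<zeta> * (of_real (u 0 t) * e t))"
          by (simp add: he mult.left_commute)
        have "integral {t1..t2} B = integral {t1..t2} (\<lambda>t. - (\<zeta> * exp (of_real a * \<zeta>) * (of_real (u a t) * e t))
               - (of_real (dx a u 0 t) * e t - \<zeta> * (of_real (u 0 t) * e t)))"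
          by (simp add: B_def diff_diff_eq2 diff_add_eq)
        also have "\<dots> = integral {t1..t2} ?f - integral {t1..t2} ?g" unfolding 1 2
          by (intro integral_diff i integrable_diff integrable_neg integrable_on_mult_right ia ig)
        finally show ?thesis .
      qed
      also have "\<dots> = integral {0..a} (\<lambda>x. of_real (u x t2) * heat_exp \<zeta> x t2)
         - integral {0..a} (\<lambda>x. of_real (u x t1) * heat_exp \<zeta> x t1)"
        by (rule green_identity_interior_times[OF u \<open>a > 0\<close> t])
      finally have 1: "integral {t1..t2} B = \<dots>" .
      have 2: "integral {0..t1} B + integral {t1..t2} B = integral {0..t2} B"
        using t integrable_on_subinterval[OF iB, of 0 t2]
        by (intro Henstock_Kurzweil_Integration.integral_combine) auto
      show ?thesis unfolding P_def 2[symmetric] 1 by simp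
    qed
    show ?thesis
    proof (cases "t \<le> T/2")
      case True
      then show ?thesis using that by (intro *) auto
    next
      case False
      then show ?thesis using that by (intro *[symmetric]) auto
    qed
  qed
  have cl: "closure {0<..<T} = {0..T}" using \<open>T > 0\<close> by simp
  have "P t = P (T/2)" if "t \<in> {0..T}" for t
    using cP const that unfolding cl[symmetric] by (rule continuous_constant_on_closure)
  from this[of T] this[of 0] have "P T = P 0" using \<open>T > 0\<close> by simp
  moreover have "P 0 = 0"
  proof -
    \<comment> \<open>The initial condition is given in the open interval; continuity extends it to the corners.\<close>
    have "u x 0 = 0" if "x \<in> {0..a}" for x
    proof (rule continuous_constant_on_closure[of "{0<..<a}" "\<lambda>x. u x 0"])
      show "continuous_on (closure {0<..<a}) (\<lambda>x. u x 0)"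
        using continuous_on_compose2[OF cu, of "{0..a}" "\<lambda>x. (x,0)"] \<open>a > 0\<close> \<open>T > 0\<close>
          continuous_on_Pair[OF continuous_on_id continuous_on_const, of "{0..a}" 0]
        by (simp add: image_subset_iff)
    qed (use u that \<open>a > 0\<close> in \<open>auto simp: heat_solution_def\<close>)
    then have "integral {0..a} (\<lambda>x. of_real (u x 0) * heat_exp \<zeta> x 0) = integral {0..a} (\<lambda>x. 0)"
      by (intro integral_cong) auto
    then show ?thesis by (simp add: P_def)
  qed
  ultimately have "integral {0..a} (\<lambda>x. of_real (u x T) * heat_exp \<zeta> x T) = integral {0..T} B"
    by (simp add: P_def)
  also have "\<dots> = - \<zeta> * exp (of_real a * \<zeta>) * integral {0..T} (\<lambda>t. of_real (u a t) * e t)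
         - integral {0..T} (\<lambda>t. of_real (dx a u 0 t) * e t)
         + \<zeta> * integral {0..T} (\<lambda>t. of_real (u 0 t) * e t)"
    unfolding B_def
    using has_integral_add[OF has_integral_diff[OF has_integral_neg[OF has_integral_mult_right[OF
        integrable_integral[OF ia(1)]]] integrable_integral[OF ig]] has_integral_mult_right[OF
        integrable_integral[OF ia(2)]], THEN integral_unique]
    by simp
  finally show ?thesis unfolding e_def .
qed

section \<open>The indicator function in terms of the flux and the final value\<close>

lemma vfun_eq_heat_exp: "vfun c \<tau> = heat_exp (zpar c \<tau>)"
  by (intro ext) (simp add: vfun_def heat_exp_def exp_diff exp_minus field_simps)

lemma indicator_fun_eq:
  fixes c \<tau> s :: real
  assumes u: "heat_solution a T u" and "a > 0"
  defines "z \<equiv> zpar c \<tau>"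
  shows "indicator_fun a T u c \<tau> s = of_real (exp (\<tau> * s)) *
     (integral {0..T} (\<lambda>t. of_real (dx a u 0 t) * exp (- (z\<^sup>2 * of_real t)))
      - z * integral {0..T} (\<lambda>t. of_real (u 0 t) * exp (- (z\<^sup>2 * of_real t))))"
proof -
  let ?e = "\<lambda>t. exp (- (z\<^sup>2 * complex_of_real t))"
  have "continuous_on {0..T} (\<lambda>t. u 0 t)"
    using continuous_on_compose2[OF continuous_on_closed_strip[OF u], of "{0..T}" "\<lambda>t. (0,t)"]
      continuous_on_Pair[of "{0..T}" "\<lambda>t. 0" "\<lambda>t. t"] \<open>a > 0\<close>
    by (auto simp: image_subset_iff)
  then have "(\<lambda>t. of_real (u 0 t) * ?e t) integrable_on {0..T}"
    by (intro integrable_continuous_real continuous_intros)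
  moreover have "(\<lambda>t. of_real (dx a u 0 t) * ?e t) integrable_on {0..T}"
    by (rule laplace_integrable[OF flux_absolutely_integrable[OF u]])
  ultimately have "integral {0..T} (\<lambda>t. of_real (dx a u 0 t) * ?e t - z * (of_real (u 0 t) * ?e t))
     = integral {0..T} (\<lambda>t. of_real (dx a u 0 t) * ?e t) - z * integral {0..T} (\<lambda>t. of_real (u 0 t) * ?e t)"
    by (subst integral_diff) (auto intro: integrable_on_mult_right)
  moreover have "vfun_x c \<tau> 0 t = z * ?e t" "vfun c \<tau> 0 t = ?e t" for t
    using vector_derivative_at[OF heat_exp_has_vector_derivative_space[where \<zeta>=z and x=0 and t=t and S=UNIV]]
    by (simp_all add: vfun_x_def vfun_eq_heat_exp z_def heat_exp_def)
  then have "indicator_fun a T u c \<tau> s = of_real (exp (\<tau> * s)) *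
     integral {0..T} (\<lambda>t. of_real (dx a u 0 t) * ?e t - z * (of_real (u 0 t) * ?e t))"
    by (simp add: indicator_fun_def mult_ac)
  ultimately show ?thesis by simp
qed

text \<open>
  Green's identity for \<open>\<zeta>\<close> and for \<open>- \<zeta>\<close> contains the same unknown transform \<open>W\<close> of \<open>u(a,t)\<close>, since the
  time factor depends only on \<open>\<zeta>\<^sup>2\<close>.  The combination below is the one that eliminates \<open>W\<close>.
\<close>

lemma boundary_data_representation:
  fixes \<zeta> :: complex
  assumes u: "heat_solution a T u" and "a > 0" "T > 0"
  defines "g \<equiv> integral {0..T} (\<lambda>t. of_real (dx a u 0 t) * exp (- (\<zeta>\<^sup>2 * of_real t)))"
    and "w \<equiv> integral {0..T} (\<lambda>t. of_real (u 0 t) * exp (- (\<zeta>\<^sup>2 * of_real t)))"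
    and "E \<equiv> \<lambda>\<xi>. integral {0..a} (\<lambda>x. of_real (u x T) * heat_exp \<xi> x T)"
  shows "exp (- (2 * of_real a * \<zeta>)) * (g - \<zeta> * w) * (1 - exp (2 * of_real a * \<zeta>))
       = - (2 * g + E (- \<zeta>) + exp (- (2 * of_real a * \<zeta>)) * E \<zeta>)"
proof -
  define A where "A = exp (of_real a * \<zeta>)"
  define W where "W = integral {0..T} (\<lambda>t. of_real (u a t) * exp (- (\<zeta>\<^sup>2 * of_real t)))"
  have A: "A \<noteq> 0" by (simp add: A_def)
  have A2: "exp (2 * of_real a * \<zeta>) = A\<^sup>2" "exp (- (2 * of_real a * \<zeta>)) = 1 / A\<^sup>2"
    "exp (of_real a * - \<zeta>) = 1 / A"
    by (simp_all add: A_def exp_minus exp_double[symmetric] field_simps)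
  have 1: "E \<zeta> = - \<zeta> * A * W - g + \<zeta> * w"
    unfolding E_def g_def w_def W_def A_def by (rule green_identity[OF assms(1-3)])
  have 2: "E (- \<zeta>) = \<zeta> * (1 / A) * W - g - \<zeta> * w"
    unfolding E_def g_def w_def W_def A2(3)[symmetric]
    using green_identity[OF assms(1-3), of "- \<zeta>"] by simp
  show ?thesis unfolding A2 1 2 using A by (simp add: field_simps power2_eq_square)
qed

text \<open>
  The maximum of \<open>x Re \<zeta>\<close> over \<open>[0,a]\<close> is attained at one of the ends, \<open>0\<close> or \<open>a\<close>.
\<close>

lemma norm_final_value_term_le:
  fixes \<zeta> :: complex
  assumes u: "heat_solution a T u" and "a > 0" "T > 0"
  shows "norm (integral {0..a} (\<lambda>x. of_real (u x T) * heat_exp \<zeta> x T))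
     \<le> integral {0..a} (\<lambda>x. \<bar>u x T\<bar>) * exp (max 0 (a * Re \<zeta>) - T * Re (\<zeta>\<^sup>2))"
proof -
  let ?m = "exp (max 0 (a * Re \<zeta>) - T * Re (\<zeta>\<^sup>2))"
  have c: "continuous_on {0..a} (\<lambda>x. u x T)"
    using continuous_on_compose2[OF continuous_on_closed_strip[OF u], of "{0..a}" "\<lambda>x. (x,T)"]
      continuous_on_Pair[OF continuous_on_id continuous_on_const, of "{0..a}" T] \<open>T > 0\<close>
    by (auto simp: image_subset_iff)
  have "norm (integral {0..a} (\<lambda>x. of_real (u x T) * heat_exp \<zeta> x T))
     \<le> integral {0..a} (\<lambda>x. \<bar>u x T\<bar> * ?m)"
  proof (rule integral_norm_bound_integral)
    show "(\<lambda>x. of_real (u x T) * heat_exp \<zeta> x T) integrable_on {0..a}"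
      "(\<lambda>x. \<bar>u x T\<bar> * ?m) integrable_on {0..a}"
      by (intro integrable_continuous_real continuous_intros c)+
    fix x assume x: "x \<in> {0..a}"
    have "x * Re \<zeta> \<le> max 0 (a * Re \<zeta>)"
    proof (cases "0 \<le> Re \<zeta>")
      case True
      then have "x * Re \<zeta> \<le> a * Re \<zeta>" using x by (intro mult_right_mono) auto
      then show ?thesis by simp
    next
      case False
      then have "x * Re \<zeta> \<le> 0" using x by (intro mult_nonneg_nonpos) auto
      then show ?thesis by simp
    qed
    then have "norm (heat_exp \<zeta> x T) \<le> ?m"
      by (simp add: heat_exp_def norm_exp_eq_Re mult.commute)
    then show "norm (of_real (u x T) * heat_exp \<zeta> x T) \<le> \<bar>u x T\<bar> * ?m"
      by (simp add: norm_mult mult_left_mono)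
  qed
  then show ?thesis by simp
qed

section \<open>Asymptotic behaviour of the indicator function\<close>

lemma Re_zpar [simp]: "Re (zpar c \<tau>) = - (c * \<tau>)"
  by (simp add: zpar_def)

text \<open>
  The radicand in \<open>zpar\<close> is chosen so that the real part of \<open>z\<^sup>2\<close> is exactly \<open>\<tau>\<close>, although \<open>|z\<^sup>2|\<close> grows
  like \<open>\<tau>\<^sup>2\<close>.
\<close>

lemma zpar_square:
  assumes "c > 0" "\<tau> > 1 / c\<^sup>2"
  shows Re_zpar_square: "Re ((zpar c \<tau>)\<^sup>2) = \<tau>"
    and norm_zpar_square: "norm ((zpar c \<tau>)\<^sup>2) = 2 * c\<^sup>2 * \<tau>\<^sup>2 - \<tau>"
proof -
  have c2: "c\<^sup>2 > 0" using assms by simp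
  have "\<tau> > 0" using assms by (meson c2 less_trans zero_less_divide_1_iff)
  have "1 < c\<^sup>2 * \<tau>" using assms(2) c2 by (simp add: field_simps)
  then have "1 / (c\<^sup>2 * \<tau>) \<le> 1" by simp
  then have r: "(sqrt (1 - 1 / (c\<^sup>2 * \<tau>)))\<^sup>2 = 1 - 1 / (c\<^sup>2 * \<tau>)" by simp
  have Im: "(Im (zpar c \<tau>))\<^sup>2 = c\<^sup>2 * \<tau>\<^sup>2 - \<tau>"
    using \<open>\<tau> > 0\<close> assms(1)
    by (simp add: zpar_def power_mult_distrib r) (simp add: field_simps power2_eq_square)
  show "Re ((zpar c \<tau>)\<^sup>2) = \<tau>"
    using Im by (simp add: power2_eq_square algebra_simps)
  show "norm ((zpar c \<tau>)\<^sup>2) = 2 * c\<^sup>2 * \<tau>\<^sup>2 - \<tau>"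
    using Im by (simp add: norm_power cmod_power2 power_mult_distrib)
qed

lemma power_mult_exp_tendsto_0:
  fixes c \<epsilon> :: real
  assumes "c > 0" "\<epsilon> > 0"
  shows "((\<lambda>\<tau>. (2 * c\<^sup>2 * \<tau>\<^sup>2 - \<tau>) ^ n * exp (- (\<tau> * \<epsilon>))) \<longlongrightarrow> 0) at_top"
proof -
  \<comment> \<open>Distributing the exponential over the \<open>n\<close> factors, with one share to spare so that \<open>n = 0\<close>
     is included, reduces the claim to limits without a symbolic exponent.\<close>
  define d where "d = \<epsilon> / (n + 1)"
  have "d > 0" "(n + 1) * d = \<epsilon>" using assms by (auto simp: d_def)
  then have d: "d > 0" "\<epsilon> = n * d + d" by (auto simp: distrib_right)
  have "((\<lambda>\<tau>. (2 * c\<^sup>2 * \<tau>\<^sup>2 - \<tau>) * exp (- (\<tau> * d))) \<longlongrightarrow> 0) at_top"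
    "((\<lambda>\<tau>. exp (- (\<tau> * d))) \<longlongrightarrow> 0) at_top"
    using assms(1) d(1) by real_asymp+
  from tendsto_mult[OF tendsto_power[OF this(1), of n] this(2)]
  have "((\<lambda>\<tau>. ((2 * c\<^sup>2 * \<tau>\<^sup>2 - \<tau>) * exp (- (\<tau> * d))) ^ n * exp (- (\<tau> * d))) \<longlongrightarrow> 0) at_top"
    by simp
  moreover have "((2 * c\<^sup>2 * \<tau>\<^sup>2 - \<tau>) * exp (- (\<tau> * d))) ^ n * exp (- (\<tau> * d))
      = (2 * c\<^sup>2 * \<tau>\<^sup>2 - \<tau>) ^ n * exp (- (\<tau> * \<epsilon>))" for \<tau>
  proof -
    have "exp (- (\<tau> * d)) ^ n * exp (- (\<tau> * d)) = exp (- (\<tau> * \<epsilon>))"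
      unfolding exp_of_nat_mult[symmetric] exp_add[symmetric] d(2) by (simp add: distrib_left)
    then show ?thesis by (simp only: power_mult_distrib mult.assoc)
  qed
  ultimately show ?thesis by (simp only:)
qed

lemma exp_over_power_at_top:
  fixes c \<epsilon> :: real
  assumes "c > 0" "\<epsilon> > 0"
  shows "filterlim (\<lambda>\<tau>. exp (\<tau> * \<epsilon>) / (2 * c\<^sup>2 * \<tau>\<^sup>2 - \<tau>) ^ Suc n) at_top at_top"
proof -
  define d where "d = \<epsilon> / (n + 1)"
  have d: "d > 0" "Suc n * d = \<epsilon>" using assms by (auto simp: d_def)
  have "filterlim (\<lambda>\<tau>. exp (\<tau> * d) / (2 * c\<^sup>2 * \<tau>\<^sup>2 - \<tau>)) at_top at_top"
    using assms(1) d(1) by real_asymp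
  from filterlim_pow_at_top[OF zero_less_Suc[of n] this] 
  have "filterlim (\<lambda>\<tau>. (exp (\<tau> * d) / (2 * c\<^sup>2 * \<tau>\<^sup>2 - \<tau>)) ^ Suc n) at_top at_top" .
  moreover have "(exp (\<tau> * d) / (2 * c\<^sup>2 * \<tau>\<^sup>2 - \<tau>)) ^ Suc n
      = exp (\<tau> * \<epsilon>) / (2 * c\<^sup>2 * \<tau>\<^sup>2 - \<tau>) ^ Suc n" for \<tau>
    unfolding power_divide exp_of_nat_mult[symmetric] d(2)[symmetric] by (simp only: mult.left_commute)
  ultimately show ?thesis by (simp only:)
qed

text \<open>
  This is the quantitative core: up to a factor with a positive limit, \<open>|I|\<close> equals
  \<open>e\<^bsup>-2ca\<tau>\<^esup> (2c\<^sup>2\<tau>\<^sup>2 - \<tau>)\<^bsup>-(k+1)\<^esup>\<close>.  It is obtained by multiplying the exact formula of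
  \<open>boundary_data_representation\<close> by \<open>z\<^bsup>2(k+1)\<^esup>\<close>, where \<open>k\<close> is the exponent belonging to the flux: the flux
  term converges and the two final-value terms vanish in the limit.
\<close>

lemma indicator_fun_asymptotics:
  assumes "a > 0" "T > 0" and u: "heat_solution a T u"
    and "0 < T'" "T' \<le> T" "c > 0" "2 * c * a < T"
    and p: "p \<noteq> 0" "\<And>t. t \<in> {0<..<T'} \<Longrightarrow> dx a u 0 t = poly p t"
  obtains k Q where "Q > 0"
    "((\<lambda>\<tau>. cmod (indicator_fun a T u c \<tau> 0) * exp (2 * c * a * \<tau>) * (2 * c\<^sup>2 * \<tau>\<^sup>2 - \<tau>) ^ Suc k)
       \<longlongrightarrow> Q) at_top"
proof -
  define lam where "lam = (\<lambda>\<tau>. (zpar c \<tau>)\<^sup>2)"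
  define g where "g = (\<lambda>\<tau>. integral {0..T} (\<lambda>t. of_real (dx a u 0 t) * exp (- (lam \<tau> * of_real t))))"
  define E where "E = (\<lambda>\<xi>. integral {0..a} (\<lambda>x. of_real (u x T) * heat_exp \<xi> x T))"
  define K where "K = integral {0..a} (\<lambda>x. \<bar>u x T\<bar>)"
  define X where "X = (\<lambda>\<tau>. exp (- (2 * of_real a * zpar c \<tau>)) * indicator_fun a T u c \<tau> 0)"
  define Y where "Y = (\<lambda>\<tau>. 1 - exp (2 * of_real a * zpar c \<tau>))"
  have ca: "0 < c * a" "2 * (c * a) < T" using assms(1,6,7) by (simp_all add: mult.assoc)
  have ev: "\<forall>\<^sub>F \<tau> in at_top. \<tau> > 1 / c\<^sup>2" by (rule eventually_gt_at_top)
  have ev2: "\<forall>\<^sub>F \<tau> in at_top. Re (lam \<tau>) = \<tau> \<and> norm (lam \<tau>) = 2 * c\<^sup>2 * \<tau>\<^sup>2 - \<tau> \<and> \<tau> > 0"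
    using ev eventually_gt_at_top[of 0]
    by eventually_elim (simp add: lam_def zpar_square[OF \<open>c > 0\<close>])
  have Re: "filterlim (\<lambda>\<tau>. Re (lam \<tau>)) at_top at_top"
    by (rule filterlim_mono_eventually[OF filterlim_ident order_refl order_refl])
       (use ev2 in \<open>auto elim: eventually_mono\<close>)
  have decay: "((\<lambda>\<tau>. norm (lam \<tau>) ^ n * exp (- (Re (lam \<tau>) * \<epsilon>))) \<longlongrightarrow> 0) at_top" if "\<epsilon> > 0" for n \<epsilon>
    by (rule Lim_transform_eventually[OF power_mult_exp_tendsto_0[OF \<open>c > 0\<close> that, of n]])
       (use ev2 in \<open>auto elim: eventually_mono\<close>)
  obtain k C where C: "C \<noteq> 0" "((\<lambda>\<tau>. lam \<tau> ^ Suc k * g \<tau>) \<longlongrightarrow> C) at_top"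
    unfolding g_def
    using laplace_initially_polynomial_asymptotics[OF \<open>0 < T'\<close> \<open>T' \<le> T\<close> Re decay flux_absolutely_integrable[OF u] p]
    by blast
  \<comment> \<open>An exponentially small remainder stays negligible after multiplication by a power of \<open>z\<^sup>2\<close>.\<close>
  have exp_small: "((\<lambda>\<tau>. lam \<tau> ^ Suc k * R \<tau>) \<longlongrightarrow> 0) at_top"
    if R: "\<forall>\<^sub>F \<tau> in at_top. norm (R \<tau>) \<le> K * exp (- (\<tau> * \<epsilon>))" and "\<epsilon> > 0" for R :: "real \<Rightarrow> complex" and \<epsilon>
  proof (rule Lim_null_comparison)
    show "((\<lambda>\<tau>. K * ((2 * c\<^sup>2 * \<tau>\<^sup>2 - \<tau>) ^ Suc k * exp (- (\<tau> * \<epsilon>)))) \<longlongrightarrow> 0) at_top"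
      by (rule tendsto_mult_right_zero power_mult_exp_tendsto_0 \<open>c > 0\<close> \<open>\<epsilon> > 0\<close>)+
    show "\<forall>\<^sub>F \<tau> in at_top. norm (lam \<tau> ^ Suc k * R \<tau>) \<le> K * ((2 * c\<^sup>2 * \<tau>\<^sup>2 - \<tau>) ^ Suc k * exp (- (\<tau> * \<epsilon>)))"
      using ev2 R
    proof eventually_elim
      case (elim \<tau>)
      have "norm (lam \<tau> ^ Suc k * R \<tau>) \<le> norm (lam \<tau>) ^ Suc k * (K * exp (- (\<tau> * \<epsilon>)))"
        unfolding norm_mult norm_power
        by (rule mult_left_mono[OF elim(2)]) (intro zero_le_power norm_ge_zero)
      then show ?case using elim(1) by (simp only: mult.left_commute)
    qed
  qed
  have E1: "((\<lambda>\<tau>. lam \<tau> ^ Suc k * E (- zpar c \<tau>)) \<longlongrightarrow> 0) at_top"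
  proof (rule exp_small)
    show "T - c * a > 0" using ca by linarith
    show "\<forall>\<^sub>F \<tau> in at_top. norm (E (- zpar c \<tau>)) \<le> K * exp (- (\<tau> * (T - c * a)))"
      using ev2
    proof eventually_elim
      case (elim \<tau>)
      then have "max 0 (a * (c * \<tau>)) = a * (c * \<tau>)" using \<open>a > 0\<close> \<open>c > 0\<close> by simp
      then show ?case
        using norm_final_value_term_le[OF u \<open>a > 0\<close> \<open>T > 0\<close>, of "- zpar c \<tau>"] elim
        unfolding E_def K_def lam_def by (simp add: algebra_simps)
    qed
  qed
  \<comment> \<open>This term decides how small \<open>c\<close> must be: \<open>exp (- 2 a z)\<close> has modulus \<open>exp (2 c a \<tau>)\<close>,
     which is beaten by the factor \<open>exp (- \<tau> T)\<close> of the final value.\<close>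
  have E2: "((\<lambda>\<tau>. lam \<tau> ^ Suc k * (exp (- (2 * of_real a * zpar c \<tau>)) * E (zpar c \<tau>))) \<longlongrightarrow> 0) at_top"
  proof (rule exp_small)
    show "T - 2 * c * a > 0" using assms(7) by linarith
    show "\<forall>\<^sub>F \<tau> in at_top. norm (exp (- (2 * of_real a * zpar c \<tau>)) * E (zpar c \<tau>))
        \<le> K * exp (- (\<tau> * (T - 2 * c * a)))"
      using ev2
    proof eventually_elim
      case (elim \<tau>)
      then have m: "max 0 (a * - (c * \<tau>)) = 0" using \<open>a > 0\<close> \<open>c > 0\<close> by simp
      have "norm (E (zpar c \<tau>)) \<le> K * exp (- (T * \<tau>))"
        using norm_final_value_term_le[OF u \<open>a > 0\<close> \<open>T > 0\<close>, of "zpar c \<tau>"] elim m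
        unfolding E_def K_def lam_def by simp
      then have "norm (exp (- (2 * of_real a * zpar c \<tau>)) * E (zpar c \<tau>))
          \<le> exp (2 * a * (c * \<tau>)) * (K * exp (- (T * \<tau>)))"
        unfolding norm_mult by (intro mult_mono) (auto simp: norm_exp_eq_Re)
      also have "\<dots> = K * (exp (2 * a * (c * \<tau>)) * exp (- (T * \<tau>)))" by simp
      also have "\<dots> = K * exp (- (\<tau> * (T - 2 * c * a)))"
        unfolding exp_add[symmetric] by (simp add: algebra_simps)
      finally show ?case .
    qed
  qed
  have "((\<lambda>\<tau>. - (2 * (lam \<tau> ^ Suc k * g \<tau>) + lam \<tau> ^ Suc k * E (- zpar c \<tau>)
           + lam \<tau> ^ Suc k * (exp (- (2 * of_real a * zpar c \<tau>)) * E (zpar c \<tau>))))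
         \<longlongrightarrow> - (2 * C + 0 + 0)) at_top"
    by (intro tendsto_intros C E1 E2)
  moreover have "- (2 * (lam \<tau> ^ Suc k * g \<tau>) + lam \<tau> ^ Suc k * E (- zpar c \<tau>)
           + lam \<tau> ^ Suc k * (exp (- (2 * of_real a * zpar c \<tau>)) * E (zpar c \<tau>)))
       = lam \<tau> ^ Suc k * (X \<tau> * Y \<tau>)" for \<tau>
  proof -
    have "X \<tau> * Y \<tau> = - (2 * g \<tau> + E (- zpar c \<tau>) + exp (- (2 * of_real a * zpar c \<tau>)) * E (zpar c \<tau>))"
      using boundary_data_representation[OF u \<open>a > 0\<close> \<open>T > 0\<close>, of "zpar c \<tau>"]
      unfolding X_def Y_def g_def E_def lam_def indicator_fun_eq[OF u \<open>a > 0\<close>] by simp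
    then show ?thesis by (simp only:) (simp add: algebra_simps)
  qed
  ultimately have XY: "((\<lambda>\<tau>. lam \<tau> ^ Suc k * (X \<tau> * Y \<tau>)) \<longlongrightarrow> - 2 * C) at_top"
    by (simp only: add_0_right mult_minus_left)
  have "((\<lambda>\<tau>. exp (2 * of_real a * zpar c \<tau>)) \<longlongrightarrow> 0) at_top"
  proof (rule tendsto_norm_zero_cancel)
    have "((\<lambda>\<tau>. exp (- (2 * a * (c * \<tau>)))) \<longlongrightarrow> 0) at_top"
      using \<open>a > 0\<close> \<open>c > 0\<close> by real_asymp
    then show "((\<lambda>\<tau>. norm (exp (2 * of_real a * zpar c \<tau>))) \<longlongrightarrow> 0) at_top"
      by (simp add: norm_exp_eq_Re)
  qed
  then have Y: "(Y \<longlongrightarrow> 1) at_top"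
    unfolding Y_def using tendsto_diff[OF tendsto_const[of 1]] by fastforce
  have "((\<lambda>\<tau>. norm (lam \<tau> ^ Suc k * (X \<tau> * Y \<tau>) / Y \<tau>)) \<longlongrightarrow> norm (- 2 * C / 1)) at_top"
    by (intro tendsto_intros XY Y) simp
  moreover have "\<forall>\<^sub>F \<tau> in at_top. norm (lam \<tau> ^ Suc k * (X \<tau> * Y \<tau>) / Y \<tau>)
      = cmod (indicator_fun a T u c \<tau> 0) * exp (2 * c * a * \<tau>) * (2 * c\<^sup>2 * \<tau>\<^sup>2 - \<tau>) ^ Suc k"
    using ev2 tendsto_imp_eventually_ne[OF Y one_neq_zero]
  proof eventually_elim
    case (elim \<tau>)
    then have "norm (lam \<tau> ^ Suc k * (X \<tau> * Y \<tau>) / Y \<tau>) = norm (lam \<tau>) ^ Suc k * norm (X \<tau>)"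
      by (simp add: norm_mult norm_power norm_divide)
    moreover have "norm (X \<tau>) = exp (2 * c * a * \<tau>) * cmod (indicator_fun a T u c \<tau> 0)"
      by (simp add: X_def norm_mult norm_exp_eq_Re mult_ac)
    ultimately show ?case using elim by (simp only: mult_ac)
  qed
  ultimately have "((\<lambda>\<tau>. cmod (indicator_fun a T u c \<tau> 0) * exp (2 * c * a * \<tau>) * (2 * c\<^sup>2 * \<tau>\<^sup>2 - \<tau>) ^ Suc k)
       \<longlongrightarrow> norm (- 2 * C / 1)) at_top"
    by (rule Lim_transform_eventually)
  moreover have "norm (- 2 * C / 1) > 0" using C(1) by simp
  ultimately show thesis using that by blast
qed

theorem theorem1p1:
  fixes a T M T' c :: real and u :: "real \<Rightarrow> real \<Rightarrow> real"
  assumes "a > 0" and "T > 0"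
    and "heat_solution a T u"
    and "M > 0" and "M \<ge> 2 * a"
    and "0 < T'" and "T' \<le> T"
    and "c > 0" and "M * c < min T (2 * T')"
    and "\<exists>p :: real poly. p \<noteq> 0 \<and> (\<forall>t\<in>{0<..<T'}. dx a u 0 t = poly p t)"
  shows "((\<lambda>\<tau>. ln (cmod (indicator_fun a T u c \<tau> 0)) / \<tau>) \<longlongrightarrow> - 2 * c * a) at_top \<and>
         (\<forall>s. s \<le> 2 * c * a \<longrightarrow>
            ((\<lambda>\<tau>. cmod (indicator_fun a T u c \<tau> s)) \<longlongrightarrow> 0) at_top) \<and>
         (\<forall>s. s > 2 * c * a \<longrightarrow>
            filterlim (\<lambda>\<tau>. cmod (indicator_fun a T u c \<tau> s)) at_top at_top)"
proof -
  define N where "N = (\<lambda>\<tau>. cmod (indicator_fun a T u c \<tau> 0))"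
  define L where "L = (\<lambda>\<tau>. 2 * c\<^sup>2 * \<tau>\<^sup>2 - \<tau>)"
  have "2 * a * c \<le> M * c" using assms by (intro mult_right_mono) auto
  then have ca: "2 * c * a < T" using assms(9) by (simp add: mult_ac)
  obtain p :: "real poly" where p: "p \<noteq> 0" "\<And>t. t \<in> {0<..<T'} \<Longrightarrow> dx a u 0 t = poly p t"
    using assms(10) by blast
  obtain k Q where "Q > 0" and "((\<lambda>\<tau>. N \<tau> * exp (2 * c * a * \<tau>) * L \<tau> ^ Suc k) \<longlongrightarrow> Q) at_top"
    unfolding N_def L_def
    by (rule indicator_fun_asymptotics[OF assms(1-3,6-8) ca p]) auto
  \<comment> \<open>All three claims are read off from \<open>|I| = exp (\<tau> (s - 2 c a)) L\<^bsup>-(k+1)\<^esup> q\<close> with \<open>q\<close> tending to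
     \<open>Q > 0\<close>.\<close>
  define q where "q = (\<lambda>\<tau>. N \<tau> * exp (2 * c * a * \<tau>) * L \<tau> ^ Suc k)"
  have q: "(q \<longlongrightarrow> Q) at_top" unfolding q_def by fact
  have evL: "\<forall>\<^sub>F \<tau> in at_top. L \<tau> > 0"
    unfolding L_def using \<open>c > 0\<close> by real_asymp
  have evq: "\<forall>\<^sub>F \<tau> in at_top. q \<tau> > 0"
    using order_tendstoD(1)[OF q \<open>Q > 0\<close>] .
  have N_eq: "cmod (indicator_fun a T u c \<tau> s) = exp (\<tau> * (s - 2 * c * a)) / L \<tau> ^ Suc k * q \<tau>"
    if "L \<tau> > 0" for s \<tau>
  proof -
    have "cmod (indicator_fun a T u c \<tau> s) = exp (\<tau> * s) * N \<tau>"
      unfolding N_def indicator_fun_def by (simp add: norm_mult)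
    also have "N \<tau> = exp (- (2 * c * a * \<tau>)) / L \<tau> ^ Suc k * q \<tau>"
      using that by (simp add: q_def exp_minus field_simps)
    finally have "cmod (indicator_fun a T u c \<tau> s)
        = (exp (\<tau> * s) * exp (- (2 * c * a * \<tau>))) / L \<tau> ^ Suc k * q \<tau>" by simp
    then show ?thesis unfolding exp_add[symmetric] by (simp add: algebra_simps)
  qed
  have log_lim: "((\<lambda>\<tau>. ln (N \<tau>) / \<tau>) \<longlongrightarrow> - 2 * c * a) at_top"
  proof (rule Lim_transform_eventually)
    have inv: "((\<lambda>\<tau>::real. 1 / \<tau>) \<longlongrightarrow> 0) at_top" by real_asymp
    have lnL: "((\<lambda>\<tau>. ln (L \<tau>) / \<tau>) \<longlongrightarrow> 0) at_top"
      unfolding L_def using \<open>c > 0\<close> by real_asymp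
    have "((\<lambda>\<tau>. - 2 * c * a - real (Suc k) * (ln (L \<tau>) / \<tau>) + ln (q \<tau>) * (1 / \<tau>))
        \<longlongrightarrow> - 2 * c * a - real (Suc k) * 0 + ln Q * 0) at_top"
      using \<open>Q > 0\<close> by (intro tendsto_intros lnL inv q) auto
    then show "((\<lambda>\<tau>. - 2 * c * a - real (Suc k) * (ln (L \<tau>) / \<tau>) + ln (q \<tau>) * (1 / \<tau>))
        \<longlongrightarrow> - 2 * c * a) at_top" by simp
    show "\<forall>\<^sub>F \<tau> in at_top. - 2 * c * a - real (Suc k) * (ln (L \<tau>) / \<tau>) + ln (q \<tau>) * (1 / \<tau>)
        = ln (N \<tau>) / \<tau>"
      using evL evq eventually_gt_at_top[of 0]
    proof eventually_elim
      case (elim \<tau>)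
      have N: "N \<tau> = exp (\<tau> * (0 - 2 * c * a)) / L \<tau> ^ Suc k * q \<tau>"
        unfolding N_def by (rule N_eq[OF elim(1)])
      have "ln (N \<tau>) = \<tau> * (0 - 2 * c * a) - real (Suc k) * ln (L \<tau>) + ln (q \<tau>)"
        unfolding N using elim
        by (simp add: ln_mult_pos ln_div ln_realpow del: power_Suc of_nat_Suc)
      then show ?case using elim(3) by (simp add: field_simps)
    qed
  qed
  moreover have "((\<lambda>\<tau>. cmod (indicator_fun a T u c \<tau> s)) \<longlongrightarrow> 0) at_top" if "s \<le> 2 * c * a" for s
  proof (rule Lim_null_comparison)
    have "((\<lambda>\<tau>. 1 / L \<tau>) \<longlongrightarrow> 0) at_top"
      unfolding L_def using \<open>c > 0\<close> by real_asymp
    from tendsto_mult[OF tendsto_power[OF this, of "Suc k"] q]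
    show "((\<lambda>\<tau>. (1 / L \<tau>) ^ Suc k * q \<tau>) \<longlongrightarrow> 0) at_top" by simp
    show "\<forall>\<^sub>F \<tau> in at_top. norm (cmod (indicator_fun a T u c \<tau> s)) \<le> (1 / L \<tau>) ^ Suc k * q \<tau>"
      using evL evq eventually_gt_at_top[of 0]
    proof eventually_elim
      case (elim \<tau>)
      have "\<tau> * (s - 2 * c * a) \<le> 0" using that elim by (intro mult_nonneg_nonpos) auto
      then have "exp (\<tau> * (s - 2 * c * a)) / L \<tau> ^ Suc k * q \<tau> \<le> 1 / L \<tau> ^ Suc k * q \<tau>"
        using elim by (intro mult_right_mono divide_right_mono) auto
      then show ?case unfolding N_eq[OF elim(1), symmetric] by (simp add: power_one_over)
    qed
  qed
  moreover have "filterlim (\<lambda>\<tau>. cmod (indicator_fun a T u c \<tau> s)) at_top at_top" if "s > 2 * c * a" for s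
  proof -
    have "filterlim (\<lambda>\<tau>. exp (\<tau> * (s - 2 * c * a)) / L \<tau> ^ Suc k) at_top at_top"
      unfolding L_def using that by (intro exp_over_power_at_top \<open>c > 0\<close>) auto
    from filterlim_at_top_mult_tendsto_pos[OF q \<open>Q > 0\<close> this]
    show ?thesis
      by (rule filterlim_mono_eventually[OF _ order_refl order_refl])
         (use evL in \<open>auto elim!: eventually_mono simp: N_eq\<close>)
  qed
  ultimately show ?thesis unfolding N_def by blast
qed

end
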